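(* Let $\mathcal{A}$ be a finite alphabet with $|\mathcal{A}|\ge2$. For $X\subseteq\mathcal{A}^{\mathbb{N}}$ let $\mathcal{N}(X)=\{n\ge1: X=X^{[n]}\}$. Then $\mathcal{N}(X)$ is nonempty and has the following properties. (1) If $n\in\mathcal{N}(X)$ and $d$ divides $n$, then $d\in\mathcal{N}(X)$. (2) If $m,n\in\mathcal{N}(X)$, then their least common multiple $\mathrm{lcm}(m,n)\in\mathcal{N}(X)$. Conversely, if a subset $N\subseteq\mathbb{N}^{+}=\{1,2,3,\dots\}$ is nonempty and has properties (1) and (2) (that is, $N$ is closed under taking positive divisors and under $\mathrm{lcm}$), then there exists $X\subseteq\mathcal{A}^{\mathbb{N}}$ with $N=\mathcal{N}(X)$.
   Context: $\mathbb{N}=\{0,1,2,\dots\}$. For $\mathbf{x}=a_0a_1a_2\cdots\in\mathcal{A}^{\mathbb{N}}$, $i\ge0$, $n\ge1$, the decimation is $\psi_{i,n}(\mathbf{x})=a_ia_{i+n}a_{i+2n}\cdots$, and $\psi_{i,n}(X)=\{\psi_{i,n}(\mathbf{x}):\mathbf{x}\in X\}$. The $n$-fold interleaving of sequences $\mathbf{x}_i=a_{i,0}a_{i,1}\cdots$ ($0\le i\le n-1$) is $b_0b_1b_2\cdots$ with $b_{i+jn}=a_{i,j}$ ($0\le i\le n-1$, $j\ge0$); the $n$-fold interleaving $(\circledast_n)_{i=0}^{n-1}X_i$ of sets is the set of all $n$-fold interleavings of $(\mathbf{x}_0,\dots,\mathbf{x}_{n-1})$ with $\mathbf{x}_i\in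 X_i$. The $n$-fold interleaving closure of $X$ is $X^{[n]}=(\circledast_n)_{i=0}^{n-1}\psi_{i,n}(X)$. *)

theory Defs
  imports "HOL-Library.FuncSet"
begin

definition decimation :: "nat \<Rightarrow> nat \<Rightarrow> (nat \<Rightarrow> 'a) \<Rightarrow> (nat \<Rightarrow> 'a)" where
  "decimation i n x = (\<lambda>j. x (i + j * n))"

text \<open>Only the sequences \<open>xs 0, \<dots>, xs (n - 1)\<close> matter, and \<open>n\<close> is meant to be positive.
  The lemma below gives the usual index description.\<close>

definition interleave :: "nat \<Rightarrow> (nat \<Rightarrow> nat \<Rightarrow> 'a) \<Rightarrow> (nat \<Rightarrow> 'a)" where
  "interleave n xs = (\<lambda>k. xs (k mod n) (k div n))"

lemma interleave_index:
  assumes "i < n"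
  shows "interleave n xs (i + j * n) = xs i j"
  using assms by (simp add: interleave_def)

definition interleaving :: "nat \<Rightarrow> (nat \<Rightarrow> (nat \<Rightarrow> 'a) set) \<Rightarrow> (nat \<Rightarrow> 'a) set" where
  "interleaving n Xs = {interleave n xs | xs. \<forall>i<n. xs i \<in> Xs i}"

definition interleaving_closure :: "nat \<Rightarrow> (nat \<Rightarrow> 'a) set \<Rightarrow> (nat \<Rightarrow> 'a) set" where
  "interleaving_closure n X = interleaving n (\<lambda>i. decimation i n ` X)"

definition closure_levels :: "(nat \<Rightarrow> 'a) set \<Rightarrow> nat set" where
  "closure_levels X = {n. n \<ge> 1 \<and> X = interleaving_closure n X}"

end

(* A sequence lies in the n-fold interleaving closure of X iff it agrees on each residue class
   mod n with some member of X. For lcm m n one first mixes mod n, separately for each residue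
   mod m, and then mixes the results mod m: the residue mod lcm m n is determined by the two
   residues. Conversely, N is realized by the sequences with a period in N; the indicator
   sequence of the multiples of n is a mixture of constants and has only multiples of n as
   periods. *)

theory Submission
  imports Defs
begin

text \<open>Since \<open>k mod n + (k div n) * n = k\<close>, decimating and then interleaving
  leaves every entry at its original position. The closure thus becomes a choice of one member of
  \<open>X\<close> per residue class, with no reindexing.\<close>

lemma interleaving_closure_eq:
  assumes "n \<ge> 1"
  shows "interleaving_closure n X = {\<lambda>k. y (k mod n) k | y. \<forall>i<n. y i \<in> X}"
proof (intro subset_antisym subsetI)
  fix x assume "x \<in> interleaving_closure n X"
  then obtain xs where x: "x = interleave n xs" and xs: "\<forall>i<n. xs i \<in> decimation i n ` X"
    unfolding interleaving_closure_def interleaving_def by blast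
  from xs obtain y where y: "\<forall>i<n. y i \<in> X \<and> xs i = decimation i n (y i)"
    unfolding image_iff by metis
  have "x = (\<lambda>k. y (k mod n) k)"
    using assms y by (auto simp: x interleave_def decimation_def)
  then show "x \<in> {\<lambda>k. y (k mod n) k | y. \<forall>i<n. y i \<in> X}"
    using y by blast
next
  fix x assume "x \<in> {\<lambda>k. y (k mod n) k | y. \<forall>i<n. y i \<in> X}"
  then obtain y where x: "x = (\<lambda>k. y (k mod n) k)" and y: "\<forall>i<n. y i \<in> X"
    by blast
  have "x = interleave n (\<lambda>i. decimation i n (y i))"
    by (simp add: x interleave_def decimation_def)
  then show "x \<in> interleaving_closure n X"
    using y unfolding interleaving_closure_def interleaving_def by blast
qed

text \<open>Only one inclusion is a real condition: \<open>X\<close> always lies in its closure, as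
  the constant family \<open>y i = x\<close> shows.\<close>

lemma mem_closure_levels_iff:
  "n \<in> closure_levels X \<longleftrightarrow>
    n \<ge> 1 \<and> (\<forall>y. (\<forall>i<n. y i \<in> X) \<longrightarrow> (\<lambda>k. y (k mod n) k) \<in> X)"
proof (cases "n \<ge> 1")
  case True
  have "X \<subseteq> {\<lambda>k. y (k mod n) k | y. \<forall>i<n. y i \<in> X}"
  proof
    fix x assume "x \<in> X"
    then show "x \<in> {\<lambda>k. y (k mod n) k | y. \<forall>i<n. y i \<in> X}"
      by (intro CollectI exI[of _ "\<lambda>_. x"]) simp
  qed
  then show ?thesis
    using True unfolding closure_levels_def by (auto simp: interleaving_closure_eq)
qed (simp add: closure_levels_def)

lemma closure_levels_mix:
  assumes "n \<in> closure_levels X" and "\<And>i. i < n \<Longrightarrow> y i \<in> X"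
  shows "(\<lambda>k. y (k mod n) k) \<in> X"
  using assms by (simp add: mem_closure_levels_iff)

lemma one_mem_closure_levels: "1 \<in> closure_levels X"
  by (simp add: mem_closure_levels_iff)

text \<open>The residue mod \<open>n\<close> determines the residue mod \<open>d\<close>, so a
  mixture mod \<open>d\<close> is a mixture mod \<open>n\<close> in which members are
  repeated.\<close>

lemma closure_levels_dvd:
  assumes n: "n \<in> closure_levels X" and "d dvd n"
  shows "d \<in> closure_levels X"
  unfolding mem_closure_levels_iff
proof (intro conjI allI impI)
  show "d \<ge> 1"
    using assms by (auto simp: mem_closure_levels_iff dvd_pos_nat Suc_le_eq)
  fix y :: "nat \<Rightarrow> nat \<Rightarrow> 'a" assume "\<forall>i<d. y i \<in> X"
  then have "(\<lambda>k. y (k mod n mod d) k) \<in> X"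
    using \<open>d \<ge> 1\<close> by (intro closure_levels_mix[OF n, of "\<lambda>i. y (i mod d)"]) simp
  then show "(\<lambda>k. y (k mod d) k) \<in> X"
    by (simp add: mod_mod_cancel[OF \<open>d dvd n\<close>])
qed

lemma closure_levels_lcm:
  assumes m: "m \<in> closure_levels X" and n: "n \<in> closure_levels X"
  shows "lcm m n \<in> closure_levels X"
  unfolding mem_closure_levels_iff
proof (intro conjI allI impI)
  let ?l = "lcm m n"
  show l: "?l \<ge> 1"
    using m n by (auto simp: mem_closure_levels_iff Suc_le_eq lcm_pos_nat)
  fix y :: "nat \<Rightarrow> nat \<Rightarrow> 'a" assume y: "\<forall>i<?l. y i \<in> X"
  \<comment> \<open>The reduction mod \<open>?l\<close> keeps the index in range when the two residues are incompatible.\<close>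
  define r where "r a b = (SOME t. t mod m = a \<and> t mod n = b) mod ?l" for a b
  have r: "r (k mod m) (k mod n) = k mod ?l" for k
  proof -
    define t where "t = (SOME t. t mod m = k mod m \<and> t mod n = k mod n)"
    have t: "t mod m = k mod m \<and> t mod n = k mod n"
      unfolding t_def by (rule someI[of _ k]) simp
    \<comment> \<open>Over the integers the difference can be formed without truncation; being a
      multiple of \<open>m\<close> and of \<open>n\<close>, it is a multiple of
      \<open>?l\<close>.\<close>
    then have "int m dvd int t - int k" "int n dvd int t - int k"
      by (metis mod_eq_dvd_iff of_nat_mod)+
    then have "lcm (int m) (int n) dvd int t - int k"
      by (rule lcm_least)
    then have "int ?l dvd int t - int k"
      by simp
    then have "t mod ?l = k mod ?l"
      by (metis mod_eq_dvd_iff of_nat_eq_iff of_nat_mod)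
    then show ?thesis
      by (simp add: r_def t_def)
  qed
  \<comment> \<open>The inner mixture, with the residue \<open>a\<close> mod \<open>m\<close>
    frozen. The outer mixture then puts \<open>k mod m\<close> for \<open>a\<close>, and at this
    compatible pair \<open>r\<close> returns \<open>k mod ?l\<close>.\<close>
  have "(\<lambda>k. y (r a (k mod n)) k) \<in> X" for a
    using y l by (intro closure_levels_mix[OF n, of "\<lambda>b. y (r a b)"]) (simp add: r_def)
  then have "(\<lambda>k. y (r (k mod m) (k mod n)) k) \<in> X"
    by (intro closure_levels_mix[OF m, of "\<lambda>a k. y (r a (k mod n)) k"])
  then show "(\<lambda>k. y (k mod ?l) k) \<in> X"
    by (simp add: r)
qed

text \<open>This supplies a common period inside \<open>N\<close> for finitely many periodic
  sequences. Nonemptiness of \<open>N\<close> covers the empty family.\<close>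

lemma lcm_closed_finite_bound:
  fixes N :: "nat set"
  assumes "N \<noteq> {}" and lcm: "\<And>m n. m \<in> N \<Longrightarrow> n \<in> N \<Longrightarrow> lcm m n \<in> N"
    and "finite F" and "F \<subseteq> N"
  shows "\<exists>m\<in>N. \<forall>p\<in>F. p dvd m"
  using assms(3,4)
proof (induction F)
  case empty
  then show ?case using \<open>N \<noteq> {}\<close> by auto
next
  case (insert q F)
  then obtain m where "m \<in> N" "\<forall>p\<in>F. p dvd m" by auto
  then show ?case
    using insert.prems by (intro bexI[of _ "lcm q m"]) (auto intro: lcm)
qed

text \<open>A mixture mod \<open>n\<close> involves only \<open>n\<close> sequences, so
  \<open>N\<close> contains a common multiple of \<open>n\<close> and their periods, and this is a
  period of the mixture.\<close>

lemma closure_levels_periodic: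
  fixes N :: "nat set"
  assumes ge1: "N \<subseteq> {1..}" and ne: "N \<noteq> {}"
    and dvd: "\<And>n d. n \<in> N \<Longrightarrow> d dvd n \<Longrightarrow> d \<in> N"
    and lcm: "\<And>m n. m \<in> N \<Longrightarrow> n \<in> N \<Longrightarrow> lcm m n \<in> N"
    and ab: "a \<in> A" "b \<in> A" "a \<noteq> b"
  shows "closure_levels {x \<in> UNIV \<rightarrow> A. \<exists>m\<in>N. \<forall>k. x (k mod m) = x k} = N"
    (is "closure_levels ?X = N")
proof (intro subset_antisym subsetI)
  fix n assume n: "n \<in> closure_levels ?X"
  have const: "(\<lambda>_. c) \<in> ?X" if "c \<in> A" for c
    using that ne by auto
  have "(\<lambda>k. if k mod n = 0 then a else b) \<in> ?X"
    using closure_levels_mix[OF n, of "\<lambda>i _. if i = 0 then a else b"]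
      const[OF ab(1)] const[OF ab(2)] by auto
  then obtain m where m: "m \<in> N"
    and per: "\<And>k. (if k mod m mod n = 0 then a else b) = (if k mod n = 0 then a else b)"
    by auto
  \<comment> \<open>At \<open>k = m\<close> the left side of \<open>per\<close> is \<open>a\<close>,
    because \<open>m mod m = 0\<close>; as \<open>a\<close> and \<open>b\<close> differ,
    \<open>m mod n = 0\<close>.\<close>
  have "n dvd m"
    using per[of m] ab by (auto split: if_splits)
  with m show "n \<in> N" by (rule dvd)
next
  fix n assume n: "n \<in> N"
  have "(\<lambda>k. y (k mod n) k) \<in> ?X" if y: "\<forall>i<n. y i \<in> ?X" for y
  proof -
    have pos: "n > 0" using n ge1 by auto
    from y have "\<forall>i\<in>{..<n}. \<exists>m. m \<in> N \<and> (\<forall>k. y i (k mod m) = y i k)" by auto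
    from bchoice[OF this] obtain p
      where p: "\<And>i. i < n \<Longrightarrow> p i \<in> N" "\<And>i k. i < n \<Longrightarrow> y i (k mod p i) = y i k"
      by auto
    \<comment> \<open>Including \<open>n\<close> makes reduction mod \<open>m\<close> preserve the
      residue mod \<open>n\<close>, so that \<open>k mod m\<close> and \<open>k\<close> select the
      same sequence \<open>y i\<close>.\<close>
    obtain m where m: "m \<in> N" and div: "\<And>q. q \<in> insert n (p ` {..<n}) \<Longrightarrow> q dvd m"
      using lcm_closed_finite_bound[OF ne lcm, of "insert n (p ` {..<n})"] n p(1) by auto
    have "y (k mod m mod n) (k mod m) = y (k mod n) k" for k
    proof -
      let ?i = "k mod n"
      have i: "?i < n" using pos by simp
      have "y ?i (k mod m) = y ?i (k mod m mod p ?i)"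
        using p(2)[OF i] by simp
      also have "\<dots> = y ?i (k mod p ?i)"
        using div i by (simp add: mod_mod_cancel)
      also have "\<dots> = y ?i k"
        using p(2)[OF i] by simp
      finally show ?thesis
        using div by (simp add: mod_mod_cancel)
    qed
    then show ?thesis
      using m y pos by (auto simp: Pi_iff)
  qed
  then show "n \<in> closure_levels ?X"
    using n ge1 by (auto simp: mem_closure_levels_iff)
qed

theorem theorem2p12:
  fixes A :: "'a set"
  assumes "finite A" and "card A \<ge> 2"
  shows "(\<forall>X. X \<subseteq> (UNIV \<rightarrow> A) \<longrightarrow>
            closure_levels X \<noteq> {} \<and>
            (\<forall>n d. n \<in> closure_levels X \<and> d dvd n \<longrightarrow> d \<in> closure_levels X) \<and>
            (\<forall>m n. m \<in> closure_levels X \<and> n \<in> closure_levels X \<longrightarrow> lcm m n \<in> closure_levels X))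
       \<and> (\<forall>N :: nat set. N \<subseteq> {1..} \<and> N \<noteq> {} \<and>
            (\<forall>n d. n \<in> N \<and> d dvd n \<longrightarrow> d \<in> N) \<and>
            (\<forall>m n. m \<in> N \<and> n \<in> N \<longrightarrow> lcm m n \<in> N) \<longrightarrow>
            (\<exists>X. X \<subseteq> (UNIV \<rightarrow> A) \<and> N = closure_levels X))"
proof (intro conjI allI impI)
  fix X :: "(nat \<Rightarrow> 'a) set"
  show "closure_levels X \<noteq> {}"
    using one_mem_closure_levels by blast
next
  fix X :: "(nat \<Rightarrow> 'a) set" and n d
  assume "n \<in> closure_levels X \<and> d dvd n"
  then show "d \<in> closure_levels X"
    using closure_levels_dvd by blast
next
  fix X :: "(nat \<Rightarrow> 'a) set" and m n
  assume "m \<in> closure_levels X \<and> n \<in> closure_levels X"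
  then show "lcm m n \<in> closure_levels X"
    using closure_levels_lcm by blast
next
  fix N :: "nat set"
  assume "N \<subseteq> {1..} \<and> N \<noteq> {} \<and> (\<forall>n d. n \<in> N \<and> d dvd n \<longrightarrow> d \<in> N) \<and>
    (\<forall>m n. m \<in> N \<and> n \<in> N \<longrightarrow> lcm m n \<in> N)"
  then have N: "N \<subseteq> {1..}" "N \<noteq> {}" "\<And>n d. n \<in> N \<Longrightarrow> d dvd n \<Longrightarrow> d \<in> N"
    "\<And>m n. m \<in> N \<Longrightarrow> n \<in> N \<Longrightarrow> lcm m n \<in> N"
    by iprover+
  \<comment> \<open>A finite set whose elements all coincide has cardinality at most 1.\<close>
  obtain a b where "a \<in> A" "b \<in> A" "a \<noteq> b"
    using assms(2) card_le_Suc0_iff_eq[OF assms(1)] by fastforce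
  with N have "closure_levels {x \<in> UNIV \<rightarrow> A. \<exists>m\<in>N. \<forall>k. x (k mod m) = x k} = N"
    by (rule closure_levels_periodic)
  then show "\<exists>X. X \<subseteq> (UNIV \<rightarrow> A) \<and> N = closure_levels X"
    by (intro exI[of _ "{x \<in> UNIV \<rightarrow> A. \<exists>m\<in>N. \<forall>k. x (k mod m) = x k}"]
        conjI Collect_restrict) (rule sym)
qed

end
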